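(* Let $(r_{i,j})_{1\le i\le n,\,1\le j\le M}$ be a matrix of ratings in $[0,1]$ ($r_{i,j}$ is user $i$'s rating of item $j$). Let $\bar r_i:=\frac1M\sum_{j=1}^Mr_{i,j}$ be user $i$'s rating mean and $\sigma_i^2:=\frac1M\sum_{j=1}^M(r_{i,j}-\bar r_i)^2$ user $i$'s rating variance. Let $\mu_i$ be user $i$'s rating distribution with CDF $F_i$, and let $X_i\sim\mu_i$ ($1\le i\le n$) be monotone coupled, i.e. $X_k=F_k^{-1}\circ F_i(X_i)$ for each $i,k$. With $W_{\mathrm{scale}}$ and $W_{\mathrm{ratings}}$ as defined in the context: (a) $$W_{\mathrm{scale}}=\frac{\sum_{i=1}^n\sum_{k=1}^n\operatorname{Cov}(X_i,X_k)}{n\sum_{i=1}^n\operatorname{Var}(X_i)}=\frac{\sum_{i=1}^n\sum_{k=1}^n\Big[\Big(\sum_{j=1}^Mr_{i,(j)}r_{k,(j)}\Big)-M\bar r_i\bar r_k\Big]}{nM\sum_{i=1}^n\sigma_i^2},$$ where $r_{i,(j)}$ is the $j$-th lowest rating from user $i$. (b) $$W_{\mathrm{ratings}}=\frac{\sum_{i=1}^n\sum_{k=1}^n\sum_{\ell=1}^n\sum_{p=1}^n\operatorname{Cov}(Y_{i,k},Y_{\ell,p})}{n^3\sum_{i=1}^n\operatorname{Var}(X_i)}=\frac{\sum_{i=1}^n\sum_{k=1}^n\sum_{\ell=1}^n\sum_{p=1}^n\Big[\Big(\sum_{j=1}^Mr_{k,(\mathrm{ind}(r_{i,j}))}\,r_{p,(\mathrm{ind}(r_{\ell,j}))}\Big)-M\bar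 r_i\bar r_k\Big]}{n^3M\sum_{i=1}^n\sigma_i^2},$$ where $Y_{i,k}:=F_k^{-1}\circ F_i(r_{i,J})$ with $J\sim\mathrm{Uniform}(\{1,\dots,M\})$, and $\mathrm{ind}(r_{i,j})$ denotes the index of $r_{i,j}$ among user $i$'s sorted ratings $r_{i,(1)},\dots,r_{i,(M)}$, so that $r_{k,(\mathrm{ind}(r_{i,j}))}$ is the $\mathrm{ind}(r_{i,j})$-th smallest rating given by user $k$.
   Context: The $M$ items are identified with distinct points $x_1,\dots,x_M\in[0,1]$, $\mu=\frac1M\sum_{j=1}^M\delta_{x_j}$, and user $i$'s scale function $\phi_i$ satisfies $\phi_i(x_j)=r_{i,j}$; thus $\mu_i=(\phi_i)_*\mu=\frac1M\sum_j\delta_{r_{i,j}}$. For a probability measure $\lambda$ on $[0,1]$, $F_\lambda$ is its CDF and $F_\lambda^{-1}(y):=\inf\{t\in[0,1]:F_\lambda(t)\ge y\}$; $F_i:=F_{\mu_i}$. $\operatorname{Var}(\lambda)$ for a probability measure $\lambda$ is the variance of a random variable with law $\lambda$. Let $\hat\mu$ be the empirical Wasserstein-2 barycenter of $\mu_1,\dots,\mu_n$, i.e. $F_{\hat\mu}^{-1}=\frac1n\sum_{k=1}^nF_k^{-1}$, and $R_0:=\frac1n\sum_{i=1}^nF_{\hat\mu}^{-1}\circ F_i\circ\phi_i$. The concordance statistics (defined when the denominators are nonzero) are $$W_{\mathrm{scale}}:=\frac{\operatorname{Var}(\hat\mu)}{\frac1n\sum_{i=1}^n\operatorname{Var}(\mu_i)},\qquad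 W_{\mathrm{ratings}}:=\frac{\operatorname{Var}((R_0)_*\mu)}{\frac1n\sum_{i=1}^n\operatorname{Var}(\mu_i)}.$$ *)

theory Defs
  imports "HOL-Probability.Probability"
begin

text \<open>Distributions on $[0,1]$ are rendered as measures on the real line. The distribution
  function of a measure is \<^const>\<open>cdf\<close> from the library.\<close>

definition quantile :: "real measure \<Rightarrow> real \<Rightarrow> real" where
  "quantile L y = Inf {t \<in> {0..1}. cdf L t \<ge> y}"

definition Var :: "real measure \<Rightarrow> real" where
  "Var L = prob_space.variance L (\<lambda>t. t)"

definition Cov :: "'a measure \<Rightarrow> ('a \<Rightarrow> real) \<Rightarrow> ('a \<Rightarrow> real) \<Rightarrow> real" where
  "Cov P X Y = prob_space.expectation P
     (\<lambda>\<omega>. (X \<omega> - prob_space.expectation P X) * (Y \<omega> - prob_space.expectation P Y))"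

text \<open>The measure $\frac1M\sum_{j=1}^M\delta_{x_j}$. Being finitely supported, it is taken on the
  \<sigma>-algebra of all sets of reals, so that every function can be pushed forward along it and no
  measurability of the scale functions has to be assumed. Push-forwards live on the Borel sets.\<close>

definition item_measure :: "nat \<Rightarrow> (nat \<Rightarrow> real) \<Rightarrow> real measure" where
  "item_measure M x = measure_pmf (map_pmf x (pmf_of_set {1..M}))"

definition rating_measure :: "nat \<Rightarrow> (nat \<Rightarrow> real) \<Rightarrow> (nat \<Rightarrow> real \<Rightarrow> real) \<Rightarrow> nat \<Rightarrow> real measure" where
  "rating_measure M x \<phi> i = distr (item_measure M x) borel (\<phi> i)"

text \<open>The empirical Wasserstein-2 barycenter of $\mu_1,\dots,\mu_n$ is the probability measure
  on $[0,1]$ whose quantile function is the average of the quantile functions of the $\mu_k$.\<close>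

definition barycenter :: "nat \<Rightarrow> (nat \<Rightarrow> real measure) \<Rightarrow> real measure \<Rightarrow> bool" where
  "barycenter n \<mu> \<nu> \<longleftrightarrow>
     prob_space \<nu> \<and> sets \<nu> = sets borel \<and> measure \<nu> {0..1} = 1 \<and>
     (\<forall>y\<in>{0..1}. quantile \<nu> y = (1 / real n) * (\<Sum>k=1..n. quantile (\<mu> k) y))"

definition R0 :: "nat \<Rightarrow> (nat \<Rightarrow> real measure) \<Rightarrow> (nat \<Rightarrow> real \<Rightarrow> real) \<Rightarrow> real measure \<Rightarrow> real \<Rightarrow> real" where
  "R0 n \<mu> \<phi> \<nu> z = (1 / real n) * (\<Sum>i=1..n. quantile \<nu> (cdf (\<mu> i) (\<phi> i z)))"

definition W_scale :: "nat \<Rightarrow> (nat \<Rightarrow> real measure) \<Rightarrow> real measure \<Rightarrow> real" where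
  "W_scale n \<mu> \<nu> = Var \<nu> / ((1 / real n) * (\<Sum>i=1..n. Var (\<mu> i)))"

definition W_ratings :: "nat \<Rightarrow> real measure \<Rightarrow> (nat \<Rightarrow> real measure) \<Rightarrow> (nat \<Rightarrow> real \<Rightarrow> real)
    \<Rightarrow> real measure \<Rightarrow> real" where
  "W_ratings n m \<mu> \<phi> \<nu> =
     Var (distr m borel (R0 n \<mu> \<phi> \<nu>)) / ((1 / real n) * (\<Sum>i=1..n. Var (\<mu> i)))"

definition rating_mean :: "nat \<Rightarrow> (nat \<Rightarrow> real) \<Rightarrow> real" where
  "rating_mean M v = (1 / real M) * (\<Sum>j=1..M. v j)"

definition rating_variance :: "nat \<Rightarrow> (nat \<Rightarrow> real) \<Rightarrow> real" where
  "rating_variance M v = (1 / real M) * (\<Sum>j=1..M. (v j - rating_mean M v)\<^sup>2)"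

text \<open>The $j$-th lowest of $v_1,\dots,v_M$, counted with multiplicity, for $1\le j\le M$.\<close>

definition order_stat :: "nat \<Rightarrow> (nat \<Rightarrow> real) \<Rightarrow> nat \<Rightarrow> real" where
  "order_stat M v j = sort (map v [1..<Suc M]) ! (j - 1)"

text \<open>\<open>ind j\<close> is an index of $v_j$ in the sorted list $v_{(1)},\dots,v_{(M)}$. Ties are left
  open: any position that carries the value $v_j$ is admitted.\<close>

definition sorted_index :: "nat \<Rightarrow> (nat \<Rightarrow> real) \<Rightarrow> (nat \<Rightarrow> nat) \<Rightarrow> bool" where
  "sorted_index M v ind \<longleftrightarrow> (\<forall>j\<in>{1..M}. ind j \<in> {1..M} \<and> order_stat M v (ind j) = v j)"

text \<open>$X_i\sim\mu_i$ with $X_k=F_k^{-1}\circ F_i(X_i)$ almost surely for all $i,k$.\<close>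

definition monotone_coupled ::
    "nat \<Rightarrow> (nat \<Rightarrow> real measure) \<Rightarrow> 'a measure \<Rightarrow> (nat \<Rightarrow> 'a \<Rightarrow> real) \<Rightarrow> bool" where
  "monotone_coupled n \<mu> P X \<longleftrightarrow>
     prob_space P \<and>
     (\<forall>i\<in>{1..n}. X i \<in> borel_measurable P \<and> distr P borel (X i) = \<mu> i) \<and>
     (\<forall>i\<in>{1..n}. \<forall>k\<in>{1..n}. AE \<omega> in P. X k \<omega> = quantile (\<mu> k) (cdf (\<mu> i) (X i \<omega>)))"

end

theory Submission
  imports Defs
begin

text \<open>Every measure involved is uniform on a finite sample. The quantile function of such a measure
  lists its order statistics, and a distribution on $[0,1]$ is determined by its quantile
  function, so $\hat\mu$ is uniform on the averages $\frac1n\sum_k r_{k,(j)}$. The existence of a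
  monotone coupling forces all users to have the same pattern of ties, so that
  $F_k^{-1}\circ F_i$ maps $r_{i,(j)}$ to $r_{k,(j)}$ exactly. All covariances are then sample
  covariances, and the claims follow by bilinearity.\<close>

section \<open>Means, variances and covariances of finite samples\<close>

text \<open>Pushing the uniform law forward from the indices lets tied values accumulate mass; the
  Borel sigma-algebra allows equality with \<open>\<mu> i\<close> and with the barycenter.\<close>

definition empirical :: "nat \<Rightarrow> (nat \<Rightarrow> real) \<Rightarrow> real measure" where
  "empirical M a = distr (measure_pmf (pmf_of_set {1..M})) borel a"

definition sample_cov :: "nat \<Rightarrow> (nat \<Rightarrow> real) \<Rightarrow> (nat \<Rightarrow> real) \<Rightarrow> real" where
  "sample_cov M a b =
     rating_mean M (\<lambda>j. (a j - rating_mean M a) * (b j - rating_mean M b))"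

lemma rating_mean_cong:
  assumes "\<And>j. j \<in> {1..M} \<Longrightarrow> a j = b j"
  shows "rating_mean M a = rating_mean M b"
  using assms by (simp add: rating_mean_def)

lemma rating_variance_eq_rating_mean:
  "rating_variance M a = rating_mean M (\<lambda>j. (a j - rating_mean M a)\<^sup>2)"
  by (simp add: rating_variance_def rating_mean_def)

lemma rating_mean_scaled_sum:
  "rating_mean M (\<lambda>j. c * (\<Sum>k\<in>A. a k j)) = c * (\<Sum>k\<in>A. rating_mean M (a k))"
proof -
  have "(\<Sum>j=1..M. \<Sum>k\<in>A. a k j) = (\<Sum>k\<in>A. \<Sum>j=1..M. a k j)"
    by (rule sum.swap)
  then show ?thesis
    by (simp add: rating_mean_def sum_distrib_left[symmetric] sum_divide_distrib[symmetric])
qed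

lemma sample_cov_eq:
  assumes "M \<ge> 1"
  shows "real M * sample_cov M a b =
    (\<Sum>j=1..M. a j * b j) - real M * rating_mean M a * rating_mean M b"
proof -
  define ma mb where "ma = rating_mean M a" and "mb = rating_mean M b"
  have "(\<Sum>j=1..M. a j) = real M * ma" "(\<Sum>j=1..M. b j) = real M * mb"
    using assms by (auto simp: ma_def mb_def rating_mean_def)
  moreover have "real M * sample_cov M a b = (\<Sum>j=1..M. (a j - ma) * (b j - mb))"
    using assms by (simp add: sample_cov_def ma_def[symmetric] mb_def[symmetric]
        rating_mean_def[of M "\<lambda>j. (a j - ma) * (b j - mb)"])
  moreover have "(\<Sum>j=1..M. (a j - ma) * (b j - mb)) =
      (\<Sum>j=1..M. a j * b j) - mb * (\<Sum>j=1..M. a j) - ma * (\<Sum>j=1..M. b j) + real M * (ma * mb)"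
    by (simp add: algebra_simps sum.distrib sum_subtractf sum_distrib_left)
  ultimately show ?thesis
    by (simp add: ma_def[symmetric] mb_def[symmetric] algebra_simps)
qed

text \<open>Bilinearity of covariance. The index set is left general because it is the set of users
  for the barycenter and the set of pairs of users for \<open>R0\<close>.\<close>

lemma rating_variance_scaled_sum:
  "rating_variance M (\<lambda>j. c * (\<Sum>k\<in>A. a k j)) =
     c\<^sup>2 * (\<Sum>k\<in>A. \<Sum>l\<in>A. sample_cov M (a k) (a l))"
proof -
  define d where "d k j = a k j - rating_mean M (a k)" for k j
  have "c * (\<Sum>k\<in>A. a k j) - rating_mean M (\<lambda>j. c * (\<Sum>k\<in>A. a k j)) = c * (\<Sum>k\<in>A. d k j)"
    for j
    by (simp only: rating_mean_scaled_sum)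
       (simp add: d_def sum_subtractf right_diff_distrib)
  then have "rating_variance M (\<lambda>j. c * (\<Sum>k\<in>A. a k j)) =
      rating_mean M (\<lambda>j. c\<^sup>2 * (\<Sum>k\<in>A. \<Sum>l\<in>A. d k j * d l j))"
    by (simp add: rating_variance_eq_rating_mean power_mult_distrib sum_product[symmetric]
        power2_eq_square[of "sum _ _"])
  \<comment> \<open>The factor 1 gives the inner sum the shape of
    \<open>rating_mean_scaled_sum\<close>, which is then applied a second time.\<close>
  also have "\<dots> = c\<^sup>2 * (\<Sum>k\<in>A. rating_mean M (\<lambda>j. 1 * (\<Sum>l\<in>A. d k j * d l j)))"
    by (simp add: rating_mean_scaled_sum)
  also have "\<dots> = c\<^sup>2 * (\<Sum>k\<in>A. \<Sum>l\<in>A. sample_cov M (a k) (a l))"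
    by (simp only: rating_mean_scaled_sum) (simp add: sample_cov_def d_def)
  finally show ?thesis .
qed

section \<open>Uniform measures on samples\<close>

lemma integral_uniform_pmf:
  fixes f :: "nat \<Rightarrow> real"
  assumes "M \<ge> 1"
  shows "integral\<^sup>L (measure_pmf (pmf_of_set {1..M})) f = rating_mean M f"
  using assms by (subst integral_pmf_of_set) (auto simp: rating_mean_def)

lemma integral_empirical:
  fixes f :: "real \<Rightarrow> real"
  assumes "M \<ge> 1" "f \<in> borel_measurable borel"
  shows "integral\<^sup>L (empirical M a) f = rating_mean M (\<lambda>j. f (a j))"
  unfolding empirical_def using assms
  by (subst integral_distr) (auto simp: integral_uniform_pmf simp del: One_nat_def)

lemma Var_empirical:
  assumes "M \<ge> 1"
  shows "Var (empirical M a) = rating_variance M a"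
  using assms
  by (simp add: Var_def integral_empirical rating_variance_eq_rating_mean)

lemma real_distribution_empirical: "real_distribution (empirical M a)"
  unfolding empirical_def by (rule prob_space.real_distribution_distr) (simp_all add: measure_pmf.prob_space_axioms)

lemma measure_empirical:
  assumes "M \<ge> 1" "A \<in> sets borel"
  shows "measure (empirical M a) A = real (card {j \<in> {1..M}. a j \<in> A}) / real M"
proof -
  have "measure (empirical M a) A = measure (measure_pmf (pmf_of_set {1..M})) (a -` A)"
    using assms by (simp add: empirical_def measure_distr)
  also have "\<dots> = real (card ({1..M} \<inter> a -` A)) / real M"
    using assms by (subst measure_pmf_of_set) auto
  also have "{1..M} \<inter> a -` A = {j \<in> {1..M}. a j \<in> A}"
    by auto
  finally show ?thesis .
qed

lemma measure_empirical_unit_interval: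
  assumes "M \<ge> 1" "\<And>j. j \<in> {1..M} \<Longrightarrow> a j \<in> {0..1}"
  shows "measure (empirical M a) {0..1} = 1"
proof -
  have "{j \<in> {1..M}. a j \<in> {0..1}} = {1..M}"
    using assms by auto
  then show ?thesis
    using assms by (simp add: measure_empirical del: atLeastAtMost_iff)
qed

text \<open>A sample enters only through the multiset of its values. Invariance under sorting and
  dependence on the indices \<open>{1..M}\<close> alone both follow from this form.\<close>

lemma empirical_eq_pmf_of_multiset:
  assumes "M \<ge> 1"
  shows "empirical M a =
    distr (measure_pmf (pmf_of_multiset (mset (map a [1..<Suc M])))) borel (\<lambda>t. t)"
proof -
  have "mset (map a [1..<Suc M]) = image_mset a (mset_set {1..M})"
    by (simp add: atLeastLessThanSuc_atLeastAtMost del: upt_Suc)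
  then have "pmf_of_multiset (mset (map a [1..<Suc M])) = map_pmf a (pmf_of_set {1..M})"
    using assms by (simp add: map_pmf_of_set del: upt_Suc)
  then show ?thesis
    by (simp add: empirical_def map_pmf_rep_eq distr_distr comp_def del: upt_Suc)
qed

section \<open>Order statistics of a sample\<close>

lemma map_order_stat: "map (order_stat M v) [1..<Suc M] = sort (map v [1..<Suc M])"
  by (rule nth_equalityI) (auto simp: order_stat_def nth_append simp del: upt_Suc)

lemma empirical_order_stat:
  assumes "M \<ge> 1"
  shows "empirical M (order_stat M v) = empirical M v"
  by (simp only: empirical_eq_pmf_of_multiset[OF assms] map_order_stat mset_sort)

lemma empirical_cong:
  assumes "M \<ge> 1" "\<And>j. j \<in> {1..M} \<Longrightarrow> a j = b j"
  shows "empirical M a = empirical M b"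
proof -
  have "map a [1..<Suc M] = map b [1..<Suc M]"
    using assms by auto
  then show ?thesis
    using assms by (simp add: empirical_eq_pmf_of_multiset del: upt_Suc map_eq_conv)
qed

text \<open>Turns both the rating distributions and the law of \<open>R0\<close> into samples
  indexed by items.\<close>

lemma distr_item_measure: "distr (item_measure M x) borel f = empirical M (\<lambda>j. f (x j))"
  by (simp add: item_measure_def empirical_def map_pmf_rep_eq distr_distr comp_def)

lemma rating_mean_order_stat:
  assumes "M \<ge> 1"
  shows "rating_mean M (order_stat M v) = rating_mean M v"
  using integral_empirical[OF assms, of "\<lambda>t. t" v]
    integral_empirical[OF assms, of "\<lambda>t. t" "order_stat M v"] empirical_order_stat[OF assms]
  by simp

lemma order_stat_mono:
  assumes "1 \<le> i" "i \<le> j" "j \<le> M"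
  shows "order_stat M v i \<le> order_stat M v j"
  unfolding order_stat_def using assms by (intro sorted_nth_mono) auto

lemma order_stat_in:
  assumes "\<And>j. j \<in> {1..M} \<Longrightarrow> v j \<in> S" "j \<in> {1..M}"
  shows "order_stat M v j \<in> S"
proof -
  have "sort (map v [1..<Suc M]) ! (j - 1) \<in> set (sort (map v [1..<Suc M]))"
    using assms(2) by (intro nth_mem) auto
  then show ?thesis
    using assms(1) by (auto simp: order_stat_def simp del: upt_Suc)
qed

section \<open>Quantile functions of distributions on [0,1]\<close>

lemma bdd_below_unit_sublevel: "bdd_below {t \<in> {0..1::real}. Q t}"
  by (rule bdd_belowI[of _ 0]) auto

context
  fixes L :: "real measure"
  assumes dist: "real_distribution L" and unit: "measure L {0..1} = 1"
begin

interpretation real_distribution L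
  by (rule dist)

lemma cdf_unit_ge_1: "t \<ge> 1 \<Longrightarrow> cdf L t = 1"
proof -
  assume "t \<ge> 1"
  then have "measure L {0..1} \<le> measure L {..t}"
    by (intro finite_measure_mono) auto
  then show ?thesis
    using unit prob_le_1[of "{..t}"] by (simp add: cdf_def)
qed

lemma cdf_unit_less_0: "t < 0 \<Longrightarrow> cdf L t = 0"
proof -
  assume "t < 0"
  then have "measure L ({..t} \<union> {0..1}) = measure L {..t} + measure L {0..1}"
    by (intro finite_measure_Union) auto
  then show ?thesis
    using unit prob_le_1[of "{..t} \<union> {0..1}"] measure_nonneg[of L "{..t}"]
    by (simp add: cdf_def)
qed

text \<open>The Galois connection between quantile and cdf: right continuity makes the infimum
  attained, and \<open>y \<le> 1\<close> puts the point 1 into the set.\<close>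

lemma quantile_le_iff:
  assumes "y \<le> 1" "t \<in> {0..1}"
  shows "quantile L y \<le> t \<longleftrightarrow> y \<le> cdf L t"
proof
  assume "y \<le> cdf L t"
  then show "quantile L y \<le> t"
    unfolding quantile_def using assms
    by (intro cInf_lower bdd_below_unit_sublevel) auto
next
  assume le: "quantile L y \<le> t"
  show "y \<le> cdf L t"
  proof (rule ccontr)
    assume "\<not> y \<le> cdf L t"
    moreover have "(cdf L \<longlongrightarrow> cdf L t) (at_right t)"
      using cdf_is_right_cont[of t] by (simp add: continuous_within)
    ultimately have "\<forall>\<^sub>F s in at_right t. cdf L s < y"
      by (intro order_tendstoD) auto
    then obtain s where s: "s > t" "\<And>u. t < u \<Longrightarrow> u < s \<Longrightarrow> cdf L u < y"
      unfolding eventually_at_right_field by auto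
    \<comment> \<open>No point below \<open>s\<close> is admissible: those up to \<open>t\<close>
      are excluded by monotonicity of the cdf, those between \<open>t\<close> and \<open>s\<close>
      by the choice of \<open>s\<close>.\<close>
    have "s \<le> quantile L y"
      unfolding quantile_def
    proof (rule cInf_greatest)
      show "{t \<in> {0..1}. y \<le> cdf L t} \<noteq> {}"
        using assms cdf_unit_ge_1[of 1] by (auto intro!: exI[of _ 1])
      fix u assume u: "u \<in> {t \<in> {0..1}. y \<le> cdf L t}"
      then have "\<not> u \<le> t"
        using \<open>\<not> y \<le> cdf L t\<close> cdf_nondecreasing[of u t] by auto
      then show "s \<le> u"
        using s(2)[of u] u by force
    qed
    then show False
      using le s(1) by simp
  qed
qed

lemma quantile_mono:
  assumes "y \<le> z" "z \<le> 1"
  shows "quantile L y \<le> quantile L z"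
  unfolding quantile_def
proof (rule cInf_superset_mono[OF _ bdd_below_unit_sublevel])
  show "{t \<in> {0..1}. z \<le> cdf L t} \<noteq> {}"
    using assms cdf_unit_ge_1[of 1] by (auto intro!: exI[of _ 1])
qed (use assms in auto)

end

text \<open>By the Galois connection, the quantiles decide which levels each cdf reaches at a point
  of [0,1]; outside, both cdfs are 0 or 1. Levels start above 0 because
  \<open>quantile_empirical\<close> covers only those.\<close>

lemma quantile_unique:
  assumes L: "real_distribution L" "measure L {0..1} = 1"
    and K: "real_distribution K" "measure K {0..1} = 1"
    and eq: "\<And>y. 0 < y \<Longrightarrow> y \<le> 1 \<Longrightarrow> quantile L y = quantile K y"
  shows "L = K"
proof (rule cdf_unique[OF L(1) K(1)], rule ext)
  fix t :: real
  consider "t < 0" | "t \<in> {0..1}" | "t \<ge> 1"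
    by fastforce
  then show "cdf L t = cdf K t"
  proof cases
    case 2
    have iff: "y \<le> cdf L t \<longleftrightarrow> y \<le> cdf K t" if "0 < y" "y \<le> 1" for y
      using quantile_le_iff[OF L that(2) 2] quantile_le_iff[OF K that(2) 2] eq[OF that] by simp
    have "0 \<le> cdf L t" "cdf L t \<le> 1" "0 \<le> cdf K t" "cdf K t \<le> 1"
      using L(1) K(1) real_distribution.cdf_bounded_prob
        finite_borel_measure.cdf_nonneg real_distribution.finite_borel_measure_M by blast+
    \<comment> \<open>Each cdf value, taken as the level \<open>y\<close>, bounds the other cdf
      value from below; a value 0 does so by nonnegativity.\<close>
    then show ?thesis
      using iff[of "cdf L t"] iff[of "cdf K t"] by force
  qed (use cdf_unit_less_0[OF L] cdf_unit_less_0[OF K] cdf_unit_ge_1[OF L] cdf_unit_ge_1[OF K]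
      in auto)
qed

text \<open>The candidate for the monotone rearrangement of L into K. If L has atoms it need not
  push L forward to K, hence the condition on means in \<open>transport_order_stat\<close>.\<close>

definition transport :: "real measure \<Rightarrow> real measure \<Rightarrow> real \<Rightarrow> real" where
  "transport L K t = quantile K (cdf L t)"

text \<open>A composite of monotone maps is monotone, hence Borel; the levels \<open>cdf L t\<close>
  stay at most 1, where \<open>quantile_mono\<close> applies.\<close>

lemma borel_measurable_transport:
  assumes "real_distribution L" "real_distribution K" "measure K {0..1} = 1"
  shows "transport L K \<in> borel_measurable borel"
proof (rule borel_measurable_mono, rule monoI)
  fix s t :: real assume "s \<le> t"
  then show "transport L K s \<le> transport L K t"
    unfolding transport_def
    by (intro quantile_mono assms real_distribution.cdf_bounded_prob
        finite_borel_measure.cdf_nondecreasing real_distribution.finite_borel_measure_M)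
qed

section \<open>Quantiles, transport and barycenters of sorted samples\<close>

context
  fixes M :: nat and a :: "nat \<Rightarrow> real"
  assumes M: "M \<ge> 1"
    and unit: "\<And>j. j \<in> {1..M} \<Longrightarrow> a j \<in> {0..1}"
    and mono: "\<And>i j. 1 \<le> i \<Longrightarrow> i \<le> j \<Longrightarrow> j \<le> M \<Longrightarrow> a i \<le> a j"
begin

text \<open>Sublevel sets of a nondecreasing sample are initial segments of \<open>{1..M}\<close>,
  so their size is also their last index.\<close>

lemma le_card_sublevel_iff:
  assumes "j \<in> {1..M}"
  shows "j \<le> card {l \<in> {1..M}. a l \<le> t} \<longleftrightarrow> a j \<le> t"
proof
  assume "a j \<le> t"
  then have "{1..j} \<subseteq> {l \<in> {1..M}. a l \<le> t}"
    using assms mono by (fastforce intro: order_trans)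
  from card_mono[OF _ this] show "j \<le> card {l \<in> {1..M}. a l \<le> t}"
    by simp
next
  assume le: "j \<le> card {l \<in> {1..M}. a l \<le> t}"
  show "a j \<le> t"
  proof (rule ccontr)
    assume "\<not> a j \<le> t"
    then have "{l \<in> {1..M}. a l \<le> t} \<subseteq> {1..<j}"
      using assms mono[of j] by (force simp: not_le)
    from card_mono[OF _ this] show False
      using le assms by auto
  qed
qed

text \<open>The cdf at \<open>t\<close> is a count divided by M, so it reaches \<open>y\<close> once
  the count reaches the ceiling of \<open>M * y\<close>, that is, once the entry at this index is at
  most \<open>t\<close>. The bound \<open>0 < y\<close> keeps the index at least 1.\<close>

lemma quantile_empirical:
  assumes "0 < y" "y \<le> 1"
  shows "quantile (empirical M a) y = a (nat \<lceil>real M * y\<rceil>)"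
proof -
  define j where "j = nat \<lceil>real M * y\<rceil>"
  have pos: "0 < real M * y"
    using M assms by simp
  have "real M * y \<le> real M"
    using M assms by simp
  then have j: "j \<in> {1..M}"
    using pos by (auto simp: j_def ceiling_le_iff nat_le_iff Suc_le_eq)
  have "y \<le> cdf (empirical M a) t \<longleftrightarrow> a j \<le> t" for t
  proof -
    define c where "c = card {l \<in> {1..M}. a l \<le> t}"
    have "y \<le> cdf (empirical M a) t \<longleftrightarrow> real M * y \<le> real c"
      using M by (simp add: cdf_def measure_empirical c_def field_simps)
    also have "\<dots> \<longleftrightarrow> j \<le> c"
      by (simp add: j_def nat_le_iff ceiling_le_iff)
    also have "\<dots> \<longleftrightarrow> a j \<le> t"
      unfolding c_def by (rule le_card_sublevel_iff[OF j])
    finally show ?thesis .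
  qed
  then have "quantile (empirical M a) y = Inf {t \<in> {0..1}. a j \<le> t}"
    by (simp add: quantile_def)
  also have "{t \<in> {0..1}. a j \<le> t} = {a j..1}"
    using unit[OF j] by auto
  finally show ?thesis
    using unit[OF j] by (simp add: j_def)
qed

end

text \<open>Ties in \<open>v\<close> can only push the transported order statistics above those of \<open>w\<close>;
  if the means agree, no such excess is possible.\<close>

lemma transport_order_stat:
  assumes M: "M \<ge> 1"
    and v: "\<And>j. j \<in> {1..M} \<Longrightarrow> v j \<in> {0..1}" and w: "\<And>j. j \<in> {1..M} \<Longrightarrow> w j \<in> {0..1}"
    and mean: "rating_mean M (\<lambda>j. transport (empirical M v) (empirical M w) (v j)) =
      rating_mean M w"
    and j: "j \<in> {1..M}"
  shows "transport (empirical M v) (empirical M w) (order_stat M v j) = order_stat M w j"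
proof -
  let ?T = "transport (empirical M v) (empirical M w)"
  have le: "order_stat M w i \<le> ?T (order_stat M v i)" if i: "i \<in> {1..M}" for i
  proof -
    \<comment> \<open>\<open>c\<close> is the last position tied with position \<open>i\<close>, so
      the cdf there is \<open>c / M\<close> and the transport lands on the \<open>c\<close>-th order
      statistic of \<open>w\<close>.\<close>
    define c where "c = card {l \<in> {1..M}. order_stat M v l \<le> order_stat M v i}"
    have "i \<le> c"
        unfolding c_def
      by (subst le_card_sublevel_iff[of M "order_stat M v" i])
        (use M i v in \<open>auto intro: order_stat_mono order_stat_in[where S = "{0..1}"]
          simp del: atLeastAtMost_iff\<close>)
    have "c \<le> card {1..M}"
      unfolding c_def by (intro card_mono) auto
    then have "c \<le> M"
      by simp
    have "cdf (empirical M v) (order_stat M v i) =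
        cdf (empirical M (order_stat M v)) (order_stat M v i)"
      by (simp add: empirical_order_stat[OF M])
    also have "\<dots> = real c / real M"
      using M by (simp add: cdf_def measure_empirical c_def)
    finally have "?T (order_stat M v i) =
        quantile (empirical M (order_stat M w)) (real c / real M)"
      by (simp add: transport_def empirical_order_stat[OF M])
    also have "\<dots> = order_stat M w (nat \<lceil>real M * (real c / real M)\<rceil>)"
      using M i \<open>i \<le> c\<close> \<open>c \<le> M\<close> w
      by (intro quantile_empirical order_stat_mono order_stat_in[where S = "{0..1}"]) auto
    also have "\<dots> = order_stat M w c"
      using M by simp
    finally show ?thesis
      using order_stat_mono[of i c M w] i \<open>i \<le> c\<close> \<open>c \<le> M\<close> by simp
  qed
  have meas: "?T \<in> borel_measurable borel"
    using M w by (intro borel_measurable_transport real_distribution_empirical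
        measure_empirical_unit_interval)
  \<comment> \<open>Reordering preserves the mean of the transported sample, so the nonnegative
    excesses over \<open>w\<close> sum to 0 and each of them vanishes.\<close>
  have "rating_mean M (\<lambda>i. ?T (order_stat M v i)) = rating_mean M (\<lambda>i. ?T (v i))"
    using integral_empirical[OF M meas, of v] integral_empirical[OF M meas, of "order_stat M v"]
      empirical_order_stat[OF M, of v] by simp
  also have "\<dots> = rating_mean M (order_stat M w)"
    by (simp add: mean rating_mean_order_stat[OF M])
  finally have "(\<Sum>i=1..M. ?T (order_stat M v i) - order_stat M w i) = 0"
    using M by (simp add: rating_mean_def sum_subtractf)
  then have "?T (order_stat M v j) - order_stat M w j = 0"
    using le j sum_nonneg_eq_0_iff[of "{1..M}" "\<lambda>i. ?T (order_stat M v i) - order_stat M w i"]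
    by (auto simp del: atLeastAtMost_iff)
  then show ?thesis
    by simp
qed

text \<open>At level \<open>y\<close> the quantile of every user is the order statistic with the
  same index, the ceiling of \<open>M * y\<close>. Averaging quantiles thus averages order
  statistics entrywise; the averages are again nondecreasing, so they are the quantiles of their own
  sample.\<close>

lemma barycenter_empirical:
  assumes M: "M \<ge> 1" and n: "n \<ge> 1"
    and r: "\<And>i j. i \<in> {1..n} \<Longrightarrow> j \<in> {1..M} \<Longrightarrow> r i j \<in> {0..1}"
    and \<mu>: "\<And>i. i \<in> {1..n} \<Longrightarrow> \<mu> i = empirical M (r i)"
    and \<nu>: "barycenter n \<mu> \<nu>"
  shows "\<nu> = empirical M (\<lambda>j. (1 / real n) * (\<Sum>k=1..n. order_stat M (r k) j))"
    (is "_ = empirical M ?a")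
proof (rule quantile_unique)
  show "real_distribution \<nu>" "measure \<nu> {0..1} = 1"
    using \<nu> by (auto simp: barycenter_def real_distribution_def real_distribution_axioms_def)
  have os: "order_stat M (r k) j \<in> {0..1}" if "k \<in> {1..n}" "j \<in> {1..M}" for k j
    using r[OF that(1)] that(2) by (rule order_stat_in)
  have unit: "?a j \<in> {0..1}" if "j \<in> {1..M}" for j
  proof -
    have "(\<Sum>k=1..n. order_stat M (r k) j) \<le> (\<Sum>k=1..n. 1)"
      "0 \<le> (\<Sum>k=1..n. order_stat M (r k) j)"
      using os that by (auto intro!: sum_mono sum_nonneg simp del: sum_constant)
    then show ?thesis
      using n by (simp add: field_simps)
  qed
  have mono: "?a i \<le> ?a j" if "1 \<le> i" "i \<le> j" "j \<le> M" for i j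
    using that by (intro mult_left_mono sum_mono order_stat_mono) auto
  show "real_distribution (empirical M ?a)" "measure (empirical M ?a) {0..1} = 1"
    using measure_empirical_unit_interval[OF M unit]
    by (simp_all add: real_distribution_empirical)
  fix y :: real assume y: "0 < y" "y \<le> 1"
  have "quantile (\<mu> k) y = order_stat M (r k) (nat \<lceil>real M * y\<rceil>)" if "k \<in> {1..n}" for k
  proof -
    have "quantile (\<mu> k) y = quantile (empirical M (order_stat M (r k))) y"
      using \<mu>[OF that] empirical_order_stat[OF M] by simp
    also have "\<dots> = order_stat M (r k) (nat \<lceil>real M * y\<rceil>)"
      using M os that y order_stat_mono by (intro quantile_empirical) auto
    finally show ?thesis .
  qed
  then have "quantile \<nu> y = ?a (nat \<lceil>real M * y\<rceil>)"
    using \<nu> y by (simp add: barycenter_def)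
  also have "\<dots> = quantile (empirical M ?a) y"
    using quantile_empirical[of M ?a y] M unit mono y by simp
  finally show "quantile \<nu> y = quantile (empirical M ?a) y" .
qed

section \<open>Covariance formulas for the two concordance statistics\<close>

theorem proposition7p1:
  fixes n M :: nat
    and r :: "nat \<Rightarrow> nat \<Rightarrow> real"
    and x :: "nat \<Rightarrow> real"
    and \<phi> :: "nat \<Rightarrow> real \<Rightarrow> real"
    and \<mu> :: "nat \<Rightarrow> real measure"
    and \<nu> :: "real measure"
    and P :: "'a measure" and X :: "nat \<Rightarrow> 'a \<Rightarrow> real"
    and Q :: "'b measure" and J :: "'b \<Rightarrow> nat" and Y :: "nat \<Rightarrow> nat \<Rightarrow> 'b \<Rightarrow> real"
    and ind :: "nat \<Rightarrow> nat \<Rightarrow> nat"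
  assumes "n \<ge> 1" and "M \<ge> 1"
    and "\<And>i j. i \<in> {1..n} \<Longrightarrow> j \<in> {1..M} \<Longrightarrow> r i j \<in> {0..1}"
    and "\<And>j. j \<in> {1..M} \<Longrightarrow> x j \<in> {0..1}"
    and "inj_on x {1..M}"
    and "\<And>i j. i \<in> {1..n} \<Longrightarrow> j \<in> {1..M} \<Longrightarrow> \<phi> i (x j) = r i j"
    and "\<mu> = rating_measure M x \<phi>"
    and "barycenter n \<mu> \<nu>"
    and "(1 / real n) * (\<Sum>i=1..n. Var (\<mu> i)) \<noteq> 0"
    and "monotone_coupled n \<mu> P X"
    and "prob_space Q"
    and "J \<in> measurable Q (count_space UNIV)"
    and "distr Q (count_space UNIV) J = measure_pmf (pmf_of_set {1..M})"
    and "\<And>i k \<omega>. Y i k \<omega> = quantile (\<mu> k) (cdf (\<mu> i) (r i (J \<omega>)))"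
    and "\<And>i. i \<in> {1..n} \<Longrightarrow> sorted_index M (r i) (ind i)"
  shows
    "(W_scale n \<mu> \<nu> =
       (\<Sum>i=1..n. \<Sum>k=1..n. Cov P (X i) (X k))
         / (real n * (\<Sum>i=1..n. prob_space.variance P (X i)))) \<and>
     ((\<Sum>i=1..n. \<Sum>k=1..n. Cov P (X i) (X k))
         / (real n * (\<Sum>i=1..n. prob_space.variance P (X i))) =
       (\<Sum>i=1..n. \<Sum>k=1..n.
           (\<Sum>j=1..M. order_stat M (r i) j * order_stat M (r k) j)
             - real M * rating_mean M (r i) * rating_mean M (r k))
         / (real n * real M * (\<Sum>i=1..n. rating_variance M (r i)))) \<and>
     (W_ratings n (item_measure M x) \<mu> \<phi> \<nu> =
       (\<Sum>i=1..n. \<Sum>k=1..n. \<Sum>l=1..n. \<Sum>p=1..n. Cov Q (Y i k) (Y l p))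
         / (real n ^ 3 * (\<Sum>i=1..n. prob_space.variance P (X i)))) \<and>
     ((\<Sum>i=1..n. \<Sum>k=1..n. \<Sum>l=1..n. \<Sum>p=1..n. Cov Q (Y i k) (Y l p))
         / (real n ^ 3 * (\<Sum>i=1..n. prob_space.variance P (X i))) =
       (\<Sum>i=1..n. \<Sum>k=1..n. \<Sum>l=1..n. \<Sum>p=1..n.
           (\<Sum>j=1..M. order_stat M (r k) (ind i j) * order_stat M (r p) (ind l j))
             - real M * rating_mean M (r i) * rating_mean M (r k))
         / (real n ^ 3 * real M * (\<Sum>i=1..n. rating_variance M (r i))))"
proof -
  note n = assms(1) and M = assms(2) and r = assms(3) and bary = assms(8)
    and coupled = assms(10) and J = assms(12,13) and Y = assms(14) and ind = assms(15)
  interpret P: prob_space P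
    using coupled by (simp add: monotone_coupled_def)
  interpret Q: prob_space Q
    by (rule assms(11))
  let ?I = "{1..n}"
  define os where "os k = order_stat M (r k)" for k
  define T where "T i k = transport (\<mu> i) (\<mu> k)" for i k
  \<comment> \<open>\<open>y i k j\<close> is the rating of item \<open>j\<close> by user
    \<open>i\<close>, translated to the scale of user \<open>k\<close>.\<close>
  define y where "y i k j = T i k (r i j)" for i k j
  have \<mu>: "\<mu> i = empirical M (r i)" if "i \<in> ?I" for i
    unfolding assms(7) rating_measure_def distr_item_measure
    using M assms(6) that by (intro empirical_cong)
  have dist: "real_distribution (\<mu> i)" if "i \<in> ?I" for i
    using \<mu>[OF that] real_distribution_empirical by simp
  have \<mu>_unit: "measure (\<mu> i) {0..1} = 1" if "i \<in> ?I" for i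
    unfolding \<mu>[OF that] using M r[OF that] by (rule measure_empirical_unit_interval)
  have T_meas [measurable]: "T i k \<in> borel_measurable borel" if "i \<in> ?I" "k \<in> ?I" for i k
    unfolding T_def using that by (intro borel_measurable_transport dist \<mu>_unit)
  have X_meas [measurable]: "X i \<in> borel_measurable P" if "i \<in> ?I" for i
    using coupled that by (simp add: monotone_coupled_def)
  have X_law: "P.expectation (\<lambda>\<omega>. f (X i \<omega>)) = rating_mean M (\<lambda>j. f (r i j))"
    if "i \<in> ?I" "f \<in> borel_measurable borel" for i and f :: "real \<Rightarrow> real"
  proof -
    have "distr P borel (X i) = empirical M (r i)"
      using coupled \<mu> that by (simp add: monotone_coupled_def)
    then show ?thesis
      using integral_distr[OF X_meas[OF that(1)] that(2)] integral_empirical[OF M that(2)]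
      by simp
  qed
  have X_AE: "AE \<omega> in P. X k \<omega> = T i k (X i \<omega>)" if "i \<in> ?I" "k \<in> ?I" for i k
    using coupled that by (simp add: monotone_coupled_def T_def transport_def)
  \<comment> \<open>The coupling enters here: \<open>T i k (X i)\<close> equals \<open>X k\<close>
    almost surely, so translated ratings have the mean of user \<open>k\<close>. This is the
    equality of means that \<open>transport_order_stat\<close> asks for.\<close>
  have y_mean: "rating_mean M (y i k) = rating_mean M (r k)" if "i \<in> ?I" "k \<in> ?I" for i k
  proof -
    have "rating_mean M (y i k) = P.expectation (\<lambda>\<omega>. T i k (X i \<omega>))"
      using X_law[OF that(1) T_meas[OF that]] by (simp add: y_def[abs_def])
    also have "\<dots> = P.expectation (X k)"
      using X_AE[OF that] that by (intro integral_cong_AE) auto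
    also have "\<dots> = rating_mean M (r k)"
      using X_law[OF that(2), of "\<lambda>t. t"] by simp
    finally show ?thesis .
  qed
  have T_os: "T i k (os i j) = os k j" if "i \<in> ?I" "k \<in> ?I" "j \<in> {1..M}" for i k j
    unfolding os_def T_def \<mu>[OF that(1)] \<mu>[OF that(2)]
  proof (rule transport_order_stat[OF M _ _ _ that(3)])
    show "rating_mean M (\<lambda>j. transport (empirical M (r i)) (empirical M (r k)) (r i j)) =
        rating_mean M (r k)"
      using y_mean[OF that(1,2)] by (simp add: y_def[abs_def] T_def \<mu>[OF that(1)] \<mu>[OF that(2)])
  qed (use r that(1,2) in blast)+
  have y_ind: "y i k j = os k (ind i j)" if "i \<in> ?I" "k \<in> ?I" "j \<in> {1..M}" for i k j
    using T_os[OF that(1,2), of "ind i j"] ind[OF that(1)] that(3)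
    by (auto simp: sorted_index_def y_def os_def)
  have Cov_X: "Cov P (X i) (X k) = sample_cov M (os i) (os k)" if "i \<in> ?I" "k \<in> ?I" for i k
  proof -
    \<comment> \<open>With \<open>X k\<close> replaced by its transport, the integrand of the
      covariance is a function of \<open>X i\<close> alone, whose law is the sample of user
      \<open>i\<close>.\<close>
    define f where
      "f t = (t - rating_mean M (r i)) * (T i k t - rating_mean M (r k))" for t
    have f [measurable]: "f \<in> borel_measurable borel"
      unfolding f_def[abs_def] using T_meas[OF that] by measurable
    have EX: "P.expectation (X l) = rating_mean M (r l)" if "l \<in> ?I" for l
      using X_law[OF that, of "\<lambda>t. t"] by simp
    have "Cov P (X i) (X k) = P.expectation (\<lambda>\<omega>. f (X i \<omega>))"
      unfolding Cov_def EX[OF that(1)] EX[OF that(2)]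
    proof (rule integral_cong_AE)
      show "AE \<omega> in P. (X i \<omega> - rating_mean M (r i)) * (X k \<omega> - rating_mean M (r k)) = f (X i \<omega>)"
        using X_AE[OF that] by eventually_elim (simp add: f_def)
    qed (use X_meas[OF that(1)] X_meas[OF that(2)] in measurable)
    also have "\<dots> = rating_mean M (\<lambda>j. f (r i j))"
      by (rule X_law[OF that(1) f])
    \<comment> \<open>Passing to the sorted sample makes \<open>T_os\<close> applicable, which turns
      the transport into the order statistics of user \<open>k\<close>.\<close>
    also have "\<dots> = rating_mean M (\<lambda>j. f (os i j))"
      using integral_empirical[OF M f, of "r i"] integral_empirical[OF M f, of "os i"]
        empirical_order_stat[OF M, of "r i"] by (simp add: os_def)
    also have "\<dots> = sample_cov M (os i) (os k)"
      unfolding sample_cov_def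
      using T_os[OF that]
      by (intro rating_mean_cong) (simp add: f_def os_def rating_mean_order_stat[OF M])
    finally show ?thesis .
  qed
  have var_X: "P.variance (X i) = rating_variance M (r i)" if "i \<in> ?I" for i
    using X_law[OF that, of "\<lambda>t. t"] X_law[OF that, of "\<lambda>t. (t - rating_mean M (r i))\<^sup>2"]
    by (simp add: rating_variance_eq_rating_mean)
  have J_law: "Q.expectation (\<lambda>\<omega>. g (J \<omega>)) = rating_mean M g" for g :: "nat \<Rightarrow> real"
    using integral_distr[OF J(1), of g] integral_uniform_pmf[OF M, of g] J(2) by simp
  have Y': "Y i k = (\<lambda>\<omega>. y i k (J \<omega>))" for i k
    by (simp add: Y y_def T_def transport_def fun_eq_iff)
  have Cov_Y: "Cov Q (Y i k) (Y l p) = sample_cov M (y i k) (y l p)" for i k l p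
    unfolding Cov_def Y' J_law sample_cov_def
    using J_law[of "\<lambda>j. (y i k j - rating_mean M (y i k)) * (y l p j - rating_mean M (y l p))"]
    by simp

  \<comment> \<open>Assembly of the four equalities\<close>
  define D where "D = (\<Sum>i\<in>?I. rating_variance M (r i))"
  have D_\<mu>: "(\<Sum>i\<in>?I. Var (\<mu> i)) = D"
    by (simp add: D_def \<mu> Var_empirical[OF M])
  have D_X: "(\<Sum>i\<in>?I. P.variance (X i)) = D"
    by (simp add: D_def var_X)
  define A where "A = (\<Sum>i\<in>?I. \<Sum>k\<in>?I. Cov P (X i) (X k))"
  define B where "B = (\<Sum>i\<in>?I. \<Sum>k\<in>?I. \<Sum>l\<in>?I. \<Sum>p\<in>?I. Cov Q (Y i k) (Y l p))"
  have Var_\<nu>: "Var \<nu> = (1 / real n)\<^sup>2 * A"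
  proof -
    have "\<nu> = empirical M (\<lambda>j. (1 / real n) * (\<Sum>k\<in>?I. os k j))"
      unfolding os_def using M n r \<mu> bary by (rule barycenter_empirical)
    then show ?thesis
      by (simp only: Var_empirical[OF M] rating_variance_scaled_sum) (simp add: A_def Cov_X)
  qed
  have Var_R0: "Var (distr (item_measure M x) borel (R0 n \<mu> \<phi> \<nu>)) = (1 / (real n)\<^sup>2)\<^sup>2 * B"
  proof -
    \<comment> \<open>At an item, \<open>R0\<close> is the average of the translated ratings over
      all pairs of users, so the variance formula applies with pairs as indices and
      \<open>c = 1 / n^2\<close>.\<close>
    have "R0 n \<mu> \<phi> \<nu> (x j) =
        1 / (real n)\<^sup>2 * (\<Sum>q\<in>?I \<times> ?I. y (fst q) (snd q) j)" if "j \<in> {1..M}" for j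
    proof -
      have "quantile \<nu> (cdf (\<mu> i) (\<phi> i (x j))) = (1 / real n) * (\<Sum>k\<in>?I. y i k j)"
        if "i \<in> ?I" for i
      proof -
        \<comment> \<open>The averaging identity for the quantiles of the barycenter is available at
          levels in [0,1].\<close>
        have "cdf (\<mu> i) (\<phi> i (x j)) \<in> {0..1}"
          using dist[OF that] real_distribution.cdf_bounded_prob
            finite_borel_measure.cdf_nonneg real_distribution.finite_borel_measure_M by force
        then show ?thesis
          using bary assms(6)[OF that \<open>j \<in> {1..M}\<close>]
          by (simp add: barycenter_def y_def T_def transport_def)
      qed
      then have "R0 n \<mu> \<phi> \<nu> (x j) = (1 / real n) * (\<Sum>i\<in>?I. (1 / real n) * (\<Sum>k\<in>?I. y i k j))"
        by (simp add: R0_def)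
      then show ?thesis
        by (simp add: sum.cartesian_product' sum_distrib_left[symmetric] power2_eq_square
            sum_divide_distrib[symmetric])
    qed
    then have "distr (item_measure M x) borel (R0 n \<mu> \<phi> \<nu>) =
        empirical M (\<lambda>j. 1 / (real n)\<^sup>2 * (\<Sum>q\<in>?I \<times> ?I. y (fst q) (snd q) j))"
      unfolding distr_item_measure by (intro empirical_cong[OF M])
    then have "Var (distr (item_measure M x) borel (R0 n \<mu> \<phi> \<nu>)) =
        (1 / (real n)\<^sup>2)\<^sup>2 * (\<Sum>q\<in>?I \<times> ?I. \<Sum>q'\<in>?I \<times> ?I.
          sample_cov M (y (fst q) (snd q)) (y (fst q') (snd q')))"
      by (simp only: Var_empirical[OF M] rating_variance_scaled_sum)
    then show ?thesis
      by (simp add: B_def Cov_Y sum.cartesian_product')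
  qed
  have scale1: "W_scale n \<mu> \<nu> = A / (real n * D)"
    using n by (simp add: W_scale_def Var_\<nu> D_\<mu> power2_eq_square del: One_nat_def)
  have "real M * A = (\<Sum>i\<in>?I. \<Sum>k\<in>?I.
      (\<Sum>j=1..M. os i j * os k j) - real M * rating_mean M (r i) * rating_mean M (r k))"
    by (simp add: A_def Cov_X sum_distrib_left sample_cov_eq[OF M])
       (simp add: os_def rating_mean_order_stat[OF M])
  then have scale2: "A / (real n * D) = (\<Sum>i\<in>?I. \<Sum>k\<in>?I.
      (\<Sum>j=1..M. os i j * os k j) - real M * rating_mean M (r i) * rating_mean M (r k))
        / (real n * real M * D)"
    using M by (metis mult.assoc mult.left_commute mult_divide_mult_cancel_left
        not_one_le_zero of_nat_eq_0_iff)
  \<comment> \<open>The factor \<open>1 / n^4\<close> of the variance meets the \<open>1 / n\<close>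
    in the denominator, leaving \<open>n^3\<close>.\<close>
  have ratings1: "W_ratings n (item_measure M x) \<mu> \<phi> \<nu> = B / (real n ^ 3 * D)"
    using n by (simp add: W_ratings_def Var_R0 D_\<mu> power2_eq_square power3_eq_cube del: One_nat_def)
  \<comment> \<open>The summand subtracts the means of users \<open>i\<close> and \<open>k\<close>, whereas
    \<open>Cov (Y i k) (Y l p)\<close> involves those of \<open>k\<close> and \<open>p\<close>;
    the two agree only after summation.\<close>
  have "real M * B = (\<Sum>i\<in>?I. \<Sum>k\<in>?I. \<Sum>l\<in>?I. \<Sum>p\<in>?I.
      (\<Sum>j=1..M. os k (ind i j) * os p (ind l j))
        - real M * rating_mean M (r k) * rating_mean M (r p))"
    by (simp add: B_def Cov_Y sum_distrib_left sample_cov_eq[OF M] y_mean y_ind)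
  also have "\<dots> = (\<Sum>i\<in>?I. \<Sum>k\<in>?I. \<Sum>l\<in>?I. \<Sum>p\<in>?I.
      (\<Sum>j=1..M. os k (ind i j) * os p (ind l j))
        - real M * rating_mean M (r i) * rating_mean M (r k))"
    by (simp add: sum_subtractf sum_distrib_left[symmetric] sum_distrib_right[symmetric] mult_ac)
  finally have ratings2: "B / (real n ^ 3 * D) = (\<Sum>i\<in>?I. \<Sum>k\<in>?I. \<Sum>l\<in>?I. \<Sum>p\<in>?I.
      (\<Sum>j=1..M. os k (ind i j) * os p (ind l j))
        - real M * rating_mean M (r i) * rating_mean M (r k))
        / (real n ^ 3 * real M * D)"
    using M by (metis mult.assoc mult.left_commute mult_divide_mult_cancel_left
        not_one_le_zero of_nat_eq_0_iff)
  show ?thesis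
    unfolding D_X unfolding A_def[symmetric] B_def[symmetric] D_def[symmetric] os_def[symmetric]
    by (intro conjI scale1 scale2 ratings1 ratings2)
qed

end
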